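(* There exist a Jordan arc $\gamma$ in $\mathbb{C}$ and a function $g$ holomorphic in a neighborhood of $\gamma$ such that the Laplace transform $$F(z)=\int_\gamma g(s)e^{zs}\,ds,\qquad z\in\mathbb{C},$$ which is an entire function of exponential type, does not have (completely) regular growth.
   Context: A Jordan arc in $\mathbb{C}$ is the image of a continuous injective map from a compact interval $[a,b]$ ($a<b$) into $\mathbb{C}$ (so it is a simple arc that is not closed); it is taken to be rectifiable, so that the contour integral $\int_\gamma g(s)e^{zs}\,ds$ is defined. An entire function $f$ is of exponential type if there are constants $C,D>0$ with $|f(z)|\le Ce^{D|z|}$ for all $z\in\mathbb{C}$. A Lebesgue measurable set $E\subset(0,\infty)$ is called an $E^0$ set (a set of relative measure $0$) if $\lim_{r\to\infty}\frac{\lambda(E\cap(0,r))}{r}=0$, where $\lambda$ is Lebesgue measure. An entire function $f$ of exponential type has (completely) regular growth if there is an $E^0$ set $E$, independent of $\theta$, such that for every real $\theta$ the limit $$\lim_{r\to\infty,\ r\notin E}\frac{\log|f(re^{i\theta})|}{r}$$ exists. Here $\log 0=-\infty$ and limits are understood in the extended real line $[-\infty,\infty]$; in particular the zero function is not regarded as having irregular growth. *)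

theory Defs
  imports "HOL-Complex_Analysis.Complex_Analysis"
begin

text \<open>
  A Jordan arc is the path image of an \<^const>\<open>arc\<close>, i.e. of a continuous map that is injective on
  the whole closed interval \<open>[0,1]\<close>; other compact intervals differ by an affine change of
  parameter. The members of a division are compact intervals \<open>K = [Inf K, Sup K]\<close>.
\<close>

definition rectifiable_path :: "(real \<Rightarrow> complex) \<Rightarrow> bool"
  where "rectifiable_path \<gamma> \<longleftrightarrow> path \<gamma> \<and>
           (\<exists>B. \<forall>\<D>. \<D> division_of {0..1} \<longrightarrow> (\<Sum>K\<in>\<D>. norm (\<gamma> (Sup K) - \<gamma> (Inf K))) \<le> B)"

text \<open>
  Contour integral along a rectifiable path, as the limit of the Riemann-Stieltjes sums
  \<open>\<Sum> f (\<gamma> \<xi>\<^sub>k) (\<gamma> t\<^sub>k\<^sub>+\<^sub>1 - \<gamma> t\<^sub>k)\<close> as the mesh tends to \<open>0\<close>. The library's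
  \<^const>\<open>has_contour_integral\<close> integrates against the pointwise derivative of \<open>\<gamma>\<close>, which
  is not appropriate for a rectifiable path whose parametrization is not absolutely continuous.
\<close>

definition has_line_integral ::
    "(complex \<Rightarrow> complex) \<Rightarrow> complex \<Rightarrow> (real \<Rightarrow> complex) \<Rightarrow> bool"
    (infixr \<open>has'_line'_integral\<close> 50)
  where "(f has_line_integral I) \<gamma> \<longleftrightarrow>
           (\<forall>\<epsilon>>0. \<exists>\<delta>>0. \<forall>p. p tagged_division_of {0..1} \<and> (\<forall>(\<xi>, K)\<in>p. Sup K - Inf K < \<delta>) \<longrightarrow>
              norm ((\<Sum>(\<xi>, K)\<in>p. f (\<gamma> \<xi>) * (\<gamma> (Sup K) - \<gamma> (Inf K))) - I) < \<epsilon>)"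

definition exponential_type :: "(complex \<Rightarrow> complex) \<Rightarrow> bool"
  where "exponential_type f \<longleftrightarrow>
           (\<exists>C>0. \<exists>D>0. \<forall>z. norm (f z) \<le> C * exp (D * norm z))"

definition rel_measure_zero :: "real set \<Rightarrow> bool"
  where "rel_measure_zero E \<longleftrightarrow> E \<in> sets lebesgue \<and> E \<subseteq> {0<..} \<and>
           ((\<lambda>r. measure lebesgue (E \<inter> {0<..<r}) / r) \<longlongrightarrow> 0) at_top"

text \<open>
  \<open>log \<bar>w\<bar>\<close> with the convention \<open>log 0 = -\<infinity>\<close> (the library has \<^term>\<open>ln 0 = (0::real)\<close>).
\<close>

definition log_norm :: "complex \<Rightarrow> ereal"
  where "log_norm w = (if w = 0 then -\<infinity> else ereal (ln (norm w)))"

text \<open>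
  Intended for entire functions of exponential type. The limit \<open>L\<close> may depend on \<open>\<theta>\<close>, and may be
  infinite; the exceptional set \<open>E\<close> does not depend on \<open>\<theta>\<close>.
\<close>

definition completely_regular_growth :: "(complex \<Rightarrow> complex) \<Rightarrow> bool"
  where "completely_regular_growth f \<longleftrightarrow>
           (\<exists>E. rel_measure_zero E \<and>
              (\<forall>\<theta>::real. \<exists>L::ereal.
                 ((\<lambda>r. log_norm (f (of_real r * cis \<theta>)) / ereal r) \<longlongrightarrow> L)
                   (inf at_top (principal (- E)))))"

end

theory Submission
  imports Defs "HOL-Real_Asymp.Real_Asymp"
begin

text \<open>
  An entire function of exponential type is a Laplace transform over a closed curve: if
  \<open>H z = (\<Sum>n. c n * z ^ n / fact n)\<close> with \<open>\<bar>c n\<bar> \<le> 1\<close>, then its Borel transform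
  \<open>g s = (\<Sum>n. c n / s ^ Suc n)\<close> is holomorphic for \<open>\<bar>s\<bar> > 1\<close>, and the integral of \<open>g s * exp (z * s)\<close>
  over the circle \<open>\<bar>s\<bar> = 2\<close> equals \<open>2 * pi * \<i> * H z\<close>. Removing the quarter of the circle in which
  \<open>Re s\<close> and \<open>Im s\<close> are positive leaves a Jordan arc \<open>\<gamma>\<close>, and on the ray \<open>z = - r\<close> the removed piece
  contributes only a bounded amount (\<open>arc_transform_near_exponential_series\<close>). So the transform \<open>F\<close>
  over \<open>\<gamma>\<close> inherits every irregularity of \<open>H\<close> on the negative axis, provided that \<open>H\<close> is
  exponentially large there at the relevant places.

  Irregular \<open>H\<close> come from lacunary series. Let \<open>c\<close> be the indicator of \<open>{300, 300\<^sup>2, 300\<^sup>3, \<dots>}\<close>. If \<open>n\<close>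
  is one of these exponents, the single term of degree \<open>n\<close> forces \<open>H (- r) \<ge> exp (2 * r / 9)\<close> for
  \<open>2 * n \<le> r \<le> 3 * n\<close> (\<open>sparse_exp_series_ge\<close>), whereas for \<open>64 * n \<le> r \<le> 96 * n\<close> the argument is far
  from all exponents and \<open>H (- r) \<le> exp (r / 8) + 1\<close> (\<open>sparse_exp_series_le\<close>). Both kinds of windows
  occupy a fixed proportion of \<open>(0, r)\<close>, so no set of relative measure zero can hide either of them
  (\<open>not_regular_growth_if_oscillating\<close>).

  The arc is continuously differentiable, which reduces its Riemann-Stieltjes line integrals to
  ordinary contour integrals (\<open>has_line_integral_C1\<close>).
\<close>

section \<open>Line integrals along continuously differentiable paths\<close>

text \<open>
  The increments of \<open>\<gamma>\<close> that occur both in the variation and in the Riemann-Stieltjes sums become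
  integrals of \<open>\<gamma>'\<close>, so that estimates on each member of a division can be added up.
\<close>

lemma path_increment_eq_integral:
  fixes \<gamma> \<gamma>' :: "real \<Rightarrow> complex"
  assumes deriv: "\<And>t. t \<in> {0..1} \<Longrightarrow> (\<gamma> has_vector_derivative \<gamma>' t) (at t within {0..1})"
    and K: "K = cbox a b" "K \<noteq> {}" "K \<subseteq> {0..1}"
  shows "Inf K = a" "Sup K = b"
    and "(\<gamma>' has_integral (\<gamma> (Sup K) - \<gamma> (Inf K))) K"
proof -
  have ab: "a \<le> b" using K by auto
  show "Inf K = a" "Sup K = b"
    using K ab by auto
  then show "(\<gamma>' has_integral (\<gamma> (Sup K) - \<gamma> (Inf K))) K"
    using K ab by (auto intro!: fundamental_theorem_of_calculus
        intro: has_vector_derivative_within_subset[OF deriv])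
qed

lemma rectifiable_path_C1:
  fixes \<gamma> \<gamma>' :: "real \<Rightarrow> complex"
  assumes deriv: "\<And>t. t \<in> {0..1} \<Longrightarrow> (\<gamma> has_vector_derivative \<gamma>' t) (at t within {0..1})"
    and cont: "continuous_on {0..1} \<gamma>'"
  shows "rectifiable_path \<gamma>"
  unfolding rectifiable_path_def
proof (intro conjI)
  show "path \<gamma>"
    unfolding path_def continuous_on_eq_continuous_within
    using deriv has_vector_derivative_continuous by blast
  have "bounded (\<gamma>' ` {0..1})"
    by (intro compact_imp_bounded compact_continuous_image cont compact_Icc)
  then obtain B where "B > 0" and B: "\<And>t. t \<in> {0..1} \<Longrightarrow> norm (\<gamma>' t) \<le> B"
    unfolding bounded_pos by blast
  show "\<exists>B. \<forall>\<D>. \<D> division_of {0..1} \<longrightarrow> (\<Sum>K\<in>\<D>. norm (\<gamma> (Sup K) - \<gamma> (Inf K))) \<le> B"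
  proof (intro exI allI impI)
    fix \<D> assume D: "\<D> division_of {0..1::real}"
    have "norm (\<gamma> (Sup K) - \<gamma> (Inf K)) \<le> B * measure lborel K" if K: "K \<in> \<D>" for K
    proof -
      from division_ofD[OF D] K obtain a b where ab: "K = cbox a b" "K \<noteq> {}" "K \<subseteq> {0..1}"
        by (metis)
      show ?thesis
        using has_integral_bound[OF _ path_increment_eq_integral(3)[OF deriv ab, unfolded ab(1)]] B ab \<open>B > 0\<close>
        by auto
    qed
    then have "(\<Sum>K\<in>\<D>. norm (\<gamma> (Sup K) - \<gamma> (Inf K))) \<le> (\<Sum>K\<in>\<D>. B * measure lborel K)"
      by (rule sum_mono)
    also have "\<dots> = B * measure lborel {0..1::real}"
      using additive_content_division[of \<D> 0 "1::real"] D by (simp flip: sum_distrib_left)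
    finally show "(\<Sum>K\<in>\<D>. norm (\<gamma> (Sup K) - \<gamma> (Inf K))) \<le> B * measure lborel {0..1::real}" .
  qed
qed

text \<open>
  Over a member \<open>K\<close> with tag \<open>\<xi>\<close>, the Riemann-Stieltjes term is the integral of
  \<open>f (\<gamma> \<xi>) * \<gamma>' t\<close>, which differs from that of \<open>f (\<gamma> t) * \<gamma>' t\<close> by at most the oscillation of
  \<open>f \<circ> \<gamma>\<close> on \<open>K\<close> times \<open>sup \<bar>\<gamma>'\<bar>\<close> times the length of \<open>K\<close>. Uniform continuity of \<open>f \<circ> \<gamma>\<close> makes
  the oscillation small for all short \<open>K\<close> at once.
\<close>

lemma has_line_integral_C1:
  fixes \<gamma> \<gamma>' :: "real \<Rightarrow> complex"
  assumes deriv: "\<And>t. t \<in> {0..1} \<Longrightarrow> (\<gamma> has_vector_derivative \<gamma>' t) (at t within {0..1})"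
    and cont: "continuous_on {0..1} \<gamma>'"
    and f: "continuous_on (path_image \<gamma>) f"
  shows "(f has_line_integral integral {0..1} (\<lambda>t. f (\<gamma> t) * \<gamma>' t)) \<gamma>"
  unfolding has_line_integral_def
proof (intro allI impI)
  fix \<epsilon> :: real assume "\<epsilon> > 0"
  have "continuous_on {0..1} \<gamma>"
    unfolding continuous_on_eq_continuous_within
    using deriv has_vector_derivative_continuous by blast
  then have cf: "continuous_on {0..1} (\<lambda>t. f (\<gamma> t))"
    by (intro continuous_on_compose2[OF f]) (auto simp: path_image_def)
  have "bounded (\<gamma>' ` {0..1})"
    by (intro compact_imp_bounded compact_continuous_image cont compact_Icc)
  then obtain B where "B > 0" and B: "\<And>t. t \<in> {0..1} \<Longrightarrow> norm (\<gamma>' t) \<le> B"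
    unfolding bounded_pos by blast
  define \<eta> where "\<eta> = \<epsilon> / (2 * B)"
  have "\<eta> > 0" using \<open>B > 0\<close> \<open>\<epsilon> > 0\<close> by (simp add: \<eta>_def)
  moreover have "uniformly_continuous_on {0..1} (\<lambda>t. f (\<gamma> t))"
    by (intro compact_uniformly_continuous cf compact_Icc)
  ultimately obtain \<delta> where "\<delta> > 0"
    and \<delta>: "\<And>s t. s \<in> {0..1} \<Longrightarrow> t \<in> {0..1} \<Longrightarrow> dist t s < \<delta> \<Longrightarrow> dist (f (\<gamma> t)) (f (\<gamma> s)) < \<eta>"
    unfolding uniformly_continuous_on_def by metis
  define h where "h = (\<lambda>t. f (\<gamma> t) * \<gamma>' t)"
  have hint: "h integrable_on cbox 0 1"
    unfolding h_def by (auto intro!: integrable_continuous_real continuous_intros cf cont)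
  show "\<exists>\<delta>>0. \<forall>p. p tagged_division_of {0..1} \<and> (\<forall>(\<xi>, K)\<in>p. Sup K - Inf K < \<delta>) \<longrightarrow>
      norm ((\<Sum>(\<xi>, K)\<in>p. f (\<gamma> \<xi>) * (\<gamma> (Sup K) - \<gamma> (Inf K))) -
        integral {0..1} (\<lambda>t. f (\<gamma> t) * \<gamma>' t)) < \<epsilon>"
  proof (intro exI conjI allI impI)
    show "\<delta> > 0" by fact
    fix p assume "p tagged_division_of {0..1} \<and> (\<forall>(\<xi>, K)\<in>p. Sup K - Inf K < \<delta>)"
    then have p: "p tagged_division_of cbox 0 1" and fine: "\<forall>(\<xi>, K)\<in>p. Sup K - Inf K < \<delta>"
      by auto
    have summand: "norm (f (\<gamma> \<xi>) * (\<gamma> (Sup K) - \<gamma> (Inf K)) - integral K h) \<le> \<eta> * B * measure lborel K"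
      if \<xi>K: "(\<xi>, K) \<in> p" for \<xi> K
    proof -
      from tagged_division_ofD[OF p] \<xi>K
      obtain a b where ab: "K = cbox a b" "K \<noteq> {}" "K \<subseteq> {0..1}" and \<xi>: "\<xi> \<in> K"
        by (metis box_real(2) empty_iff)
      note K = path_increment_eq_integral[OF deriv ab]
      have "h integrable_on K"
        using integrable_on_subcbox[OF hint] ab by auto
      then have diff: "((\<lambda>t. f (\<gamma> \<xi>) * \<gamma>' t - h t) has_integral
          f (\<gamma> \<xi>) * (\<gamma> (Sup K) - \<gamma> (Inf K)) - integral K h) K"
        by (intro has_integral_diff has_integral_mult_right K(3) integrable_integral)
      have small: "norm (f (\<gamma> \<xi>) * \<gamma>' t - h t) \<le> \<eta> * B" if t: "t \<in> K" for t
      proof -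
        have "dist \<xi> t < \<delta>"
          using t \<xi> fine \<xi>K K(1-2) ab(1) by (fastforce simp: dist_real_def)
        then have "norm (f (\<gamma> \<xi>) - f (\<gamma> t)) \<le> \<eta>"
          using \<delta>[of t \<xi>] t \<xi> ab(3) by (fastforce simp: dist_norm)
        moreover have "norm (\<gamma>' t) \<le> B" using B t ab(3) by blast
        ultimately show ?thesis
          unfolding h_def left_diff_distrib[symmetric] norm_mult
          using \<open>\<eta> > 0\<close> by (intro mult_mono) auto
      qed
      show ?thesis
        unfolding ab(1)
        by (rule has_integral_bound[OF _ diff[unfolded ab(1)] small[unfolded ab(1)]])
          (use \<open>\<eta> > 0\<close> \<open>B > 0\<close> in simp)
    qed
    have "(\<Sum>(\<xi>, K)\<in>p. f (\<gamma> \<xi>) * (\<gamma> (Sup K) - \<gamma> (Inf K))) - integral {0..1} h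
        = (\<Sum>(\<xi>, K)\<in>p. f (\<gamma> \<xi>) * (\<gamma> (Sup K) - \<gamma> (Inf K)) - integral K h)"
      using integral_combine_tagged_division_topdown[OF hint p]
      by (simp add: sum_subtractf case_prod_unfold)
    also have "norm \<dots> \<le> (\<Sum>(\<xi>, K)\<in>p. \<eta> * B * measure lborel K)"
      using summand by (intro sum_norm_le) auto
    also have "\<dots> = \<eta> * B * (\<Sum>(\<xi>, K)\<in>p. measure lborel K)"
      by (simp add: sum_distrib_left case_prod_unfold)
    also have "\<dots> = \<eta> * B"
      using additive_content_tagged_division[OF p] by simp
    also have "\<dots> < \<epsilon>" using \<open>\<epsilon> > 0\<close> \<open>B > 0\<close> by (simp add: \<eta>_def)
    finally show "norm ((\<Sum>(\<xi>, K)\<in>p. f (\<gamma> \<xi>) * (\<gamma> (Sup K) - \<gamma> (Inf K))) -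
        integral {0..1} (\<lambda>t. f (\<gamma> t) * \<gamma>' t)) < \<epsilon>" unfolding h_def .
  qed
qed

section \<open>Oscillation on windows excludes completely regular growth\<close>

text \<open>
  The window \<open>(a x\<^sub>k, b x\<^sub>k)\<close> makes up the fixed proportion \<open>(b - a) / b\<close> of \<open>(0, b x\<^sub>k)\<close>, so a set of
  relative measure zero cannot cover it once \<open>x\<^sub>k\<close> is large. Therefore a property that holds for all
  large radii outside the exceptional set is visible in every late window.
\<close>

lemma eventually_window_point:
  fixes x :: "nat \<Rightarrow> real"
  assumes E: "rel_measure_zero E" and ab: "0 < a" "a < b"
    and x: "filterlim x at_top sequentially"
    and P: "eventually P (inf at_top (principal (- E)))"
  shows "\<forall>\<^sub>F k in sequentially. \<exists>r\<in>{a * x k..b * x k}. P r"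
proof -
  let ?m = "\<lambda>r. measure lebesgue (E \<inter> {0<..<r}) / r"
  have bx: "filterlim (\<lambda>k. b * x k) at_top sequentially"
    and ax: "filterlim (\<lambda>k. a * x k) at_top sequentially"
    using ab by (auto intro!: filterlim_tendsto_pos_mult_at_top[OF tendsto_const _ x])
  have "\<forall>\<^sub>F r in at_top. ?m r < (b - a) / b"
    using E ab unfolding rel_measure_zero_def by (intro order_tendstoD(2)[where y = 0]) auto
  then have 1: "\<forall>\<^sub>F k in sequentially. ?m (b * x k) < (b - a) / b"
    using bx by (rule eventually_compose_filterlim)
  obtain R where R: "\<And>r. r \<ge> R \<Longrightarrow> r \<notin> E \<Longrightarrow> P r"
    using P unfolding eventually_inf_principal eventually_at_top_linorder by auto
  have 2: "\<forall>\<^sub>F k in sequentially. a * x k \<ge> R"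
    using ax unfolding filterlim_at_top by blast
  have 3: "\<forall>\<^sub>F k in sequentially. x k \<ge> 1"
    using x unfolding filterlim_at_top by blast
  from 1 2 3 show ?thesis
  proof eventually_elim
    case (elim k)
    have "\<exists>r\<in>{a * x k<..<b * x k}. r \<notin> E"
    proof (rule ccontr)
      assume cover: "\<not> ?thesis"
      have pos: "0 < a * x k" using ab(1) elim(3) by simp
      have sub: "{a * x k<..<b * x k} \<subseteq> E \<inter> {0<..<b * x k}"
      proof
        fix y assume y: "y \<in> {a * x k<..<b * x k}"
        then have "y \<in> E" using cover by blast
        with y pos show "y \<in> E \<inter> {0<..<b * x k}" by simp
      qed
      have le: "a * x k \<le> b * x k" using ab elim by (intro mult_right_mono) auto
      have "E \<inter> {0<..<b * x k} \<in> lmeasurable"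
        using E unfolding rel_measure_zero_def
        by (subst Int_commute) (intro fmeasurable_Int_fmeasurable, auto)
      then have "measure lebesgue {a * x k<..<b * x k} \<le> measure lebesgue (E \<inter> {0<..<b * x k})"
        using sub by (intro measure_mono_fmeasurable) auto
      then have "b * x k - a * x k \<le> measure lebesgue (E \<inter> {0<..<b * x k})"
        using le by simp
      then have "(b * x k - a * x k) / (b * x k) \<le> ?m (b * x k)"
        using ab elim by (intro divide_right_mono) auto
      moreover have "(b * x k - a * x k) / (b * x k) = (b - a) / b"
        using ab elim by (simp add: field_simps)
      ultimately show False using elim by simp
    qed
    then obtain r where "r \<in> {a * x k<..<b * x k}" "r \<notin> E" by blast
    with R[of r] elim show ?case by (intro bexI[of _ r]) auto
  qed
qed

lemma log_norm_div_le_iff: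
  assumes "r > 0"
  shows "log_norm w / ereal r \<le> ereal \<alpha> \<longleftrightarrow> norm w \<le> exp (\<alpha> * r)"
  using assms by (auto simp: log_norm_def pos_divide_le_eq ln_ge_iff
      simp flip: ln_le_cancel_iff[of "norm w" "exp _"])

text \<open>
  If the limit \<open>L\<close> on the ray existed, late windows of the first kind would contain
  non-exceptional radii with quotient at most \<open>\<alpha>\<close>, hence \<open>L \<le> \<alpha>\<close>; windows of the second kind
  give \<open>L \<ge> \<beta>\<close>.
\<close>

lemma not_regular_growth_if_oscillating:
  fixes x :: "nat \<Rightarrow> real"
  assumes ab: "0 < a" "a < b" and cd: "0 < c" "c < d" and x: "filterlim x at_top sequentially"
    and "\<alpha> < \<beta>"
    and le: "\<forall>\<^sub>F r in at_top. (\<exists>k. r \<in> {a * x k..b * x k}) \<longrightarrow>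
               norm (f (of_real r * cis \<theta>)) \<le> exp (\<alpha> * r)"
    and ge: "\<forall>\<^sub>F r in at_top. (\<exists>k. r \<in> {c * x k..d * x k}) \<longrightarrow>
               norm (f (of_real r * cis \<theta>)) > exp (\<beta> * r)"
  shows "\<not> completely_regular_growth f"
proof
  assume "completely_regular_growth f"
  then obtain E L where E: "rel_measure_zero E"
    and L: "((\<lambda>r. log_norm (f (of_real r * cis \<theta>)) / ereal r) \<longlongrightarrow> L) (inf at_top (principal (- E)))"
    (is "(?q \<longlongrightarrow> L) ?F") unfolding completely_regular_growth_def by blast
  have pos: "\<forall>\<^sub>F r in ?F. 0 < (r::real)"
    by (intro filter_leD[OF inf_le1] eventually_gt_at_top)
  note le' = filter_leD[OF inf_le1 le, of "principal (- E)"]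
  note ge' = filter_leD[OF inf_le1 ge, of "principal (- E)"]
  show False
  proof (cases "L < ereal \<beta>")
    case True
    then have "\<forall>\<^sub>F r in ?F. ?q r < ereal \<beta>" by (rule order_tendstoD(2)[OF L])
    with pos ge' have "\<forall>\<^sub>F r in ?F. (\<forall>k. r \<notin> {c * x k..d * x k})"
    proof eventually_elim
      case (elim r)
      then have "norm (f (of_real r * cis \<theta>)) \<le> exp (\<beta> * r)"
        by (metis less_imp_le log_norm_div_le_iff)
      with elim show ?case by force
    qed
    from eventually_window_point[OF E cd x this] have "\<forall>\<^sub>F k::nat in sequentially. False"
      by eventually_elim blast
    then show False by simp
  next
    case False
    then have "L > ereal \<alpha>" using \<open>\<alpha> < \<beta>\<close> by (simp add: not_less less_le_trans[of "ereal \<alpha>" "ereal \<beta>"])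
    then have "\<forall>\<^sub>F r in ?F. ?q r > ereal \<alpha>" by (rule order_tendstoD(1)[OF L])
    with pos le' have "\<forall>\<^sub>F r in ?F. (\<forall>k. r \<notin> {a * x k..b * x k})"
    proof eventually_elim
      case (elim r)
      then have "\<not> norm (f (of_real r * cis \<theta>)) \<le> exp (\<alpha> * r)"
        by (metis not_le log_norm_div_le_iff)
      with elim show ?case by force
    qed
    from eventually_window_point[OF E ab x this] have "\<forall>\<^sub>F k::nat in sequentially. False"
      by eventually_elim blast
    then show False by simp
  qed
qed

section \<open>The Borel transform on a circle and on an arc\<close>

text \<open>
  The Borel transform of the entire function of exponential type whose derivatives at \<open>0\<close> are the
  \<open>c n\<close>; that function itself is \<open>exponential_series c\<close>.
\<close>

definition inverse_power_series :: "(nat \<Rightarrow> complex) \<Rightarrow> complex \<Rightarrow> complex"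
  where "inverse_power_series c s = (\<Sum>n. c n / s ^ Suc n)"

definition exponential_series :: "(nat \<Rightarrow> complex) \<Rightarrow> complex \<Rightarrow> complex"
  where "exponential_series c z = (\<Sum>n. c n * z ^ n / fact n)"

lemma inverse_power_series_uniform_limit:
  assumes c: "\<And>n. norm (c n) \<le> 1" and "1 < R" and A: "\<And>s. s \<in> A \<Longrightarrow> R \<le> norm s"
  shows "uniform_limit A (\<lambda>N s. \<Sum>n<N. c n / s ^ Suc n) (inverse_power_series c) sequentially"
proof -
  have "norm (c n / s ^ Suc n) \<le> (1 / R) ^ Suc n" if "s \<in> A" for n s
  proof -
    have "norm (c n / s ^ Suc n) \<le> 1 / R ^ Suc n"
      unfolding norm_divide norm_power using c A[OF that] \<open>1 < R\<close>
      by (intro frac_le power_mono) auto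
    then show ?thesis by (simp add: power_divide)
  qed
  moreover have "summable (\<lambda>n. (1 / R) ^ Suc n)"
    using \<open>1 < R\<close> by (subst summable_Suc_iff) (simp add: summable_geometric)
  ultimately show ?thesis
    unfolding inverse_power_series_def by (intro Weierstrass_m_test)
qed

lemma holomorphic_inverse_power_series:
  assumes c: "\<And>n. norm (c n) \<le> 1"
  shows "inverse_power_series c holomorphic_on {s. 1 < norm s}"
proof (rule holomorphic_uniform_sequence)
  show "open {s::complex. 1 < norm s}" by (intro open_Collect_less continuous_intros)
  show "(\<lambda>s. \<Sum>n<N. c n / s ^ Suc n) holomorphic_on {s. 1 < norm s}" for N
    by (intro holomorphic_intros) auto
  fix x :: complex assume "x \<in> {s. 1 < norm s}"
  then have x: "1 < norm x" by simp
  define d where "d = (norm x - 1) / 2"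
  have far: "(norm x + 1) / 2 \<le> norm s" if "s \<in> cball x d" for s
    using that norm_triangle_ineq2[of x "x - s"] by (simp add: d_def dist_norm field_simps)
  show "\<exists>d>0. cball x d \<subseteq> {s. 1 < norm s} \<and>
      uniform_limit (cball x d) (\<lambda>N s. \<Sum>n<N. c n / s ^ Suc n) (inverse_power_series c) sequentially"
  proof (intro exI[of _ d] conjI inverse_power_series_uniform_limit[of c, OF c])
    show "d > 0" "1 < (norm x + 1) / 2" using x by (simp_all add: d_def)
    show "cball x d \<subseteq> {s. 1 < norm s}" using far x by fastforce
  qed (rule far)
qed

lemma higher_deriv_exp_mult: "(deriv ^^ n) (\<lambda>s. exp (z * s)) = (\<lambda>s. z ^ n * exp (z * s :: complex))"
proof (induction n)
  case (Suc n)
  have "deriv (\<lambda>s. z ^ n * exp (z * s)) s = z ^ Suc n * exp (z * s)" for s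
    by (rule DERIV_imp_deriv) (auto intro!: derivative_eq_intros)
  with Suc show ?case by auto
qed simp

text \<open>
  On the circle the Borel transform may be integrated term by term, and Cauchy's formula for the
  derivatives of \<open>s \<mapsto> exp (z * s)\<close> at \<open>0\<close> evaluates the integral of \<open>exp (z * s) / s ^ Suc n\<close>.
\<close>

lemma exponential_series_sums_circle_integral:
  assumes c: "\<And>n. norm (c n) \<le> 1" and "1 < R"
  shows "(\<lambda>n. 2 * of_real pi * \<i> * (c n * z ^ n / fact n)) sums
    contour_integral (circlepath 0 R) (\<lambda>s. inverse_power_series c s * exp (z * s))"
proof -
  let ?f = "\<lambda>N s. (\<Sum>n<N. c n / s ^ Suc n) * exp (z * s)"
  have "bounded ((\<lambda>s. exp (z * s)) ` sphere 0 R)"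
    by (intro compact_imp_bounded compact_continuous_image continuous_intros compact_sphere)
  moreover have "bounded (inverse_power_series c ` sphere 0 R)"
    using \<open>1 < R\<close>
    by (intro compact_imp_bounded compact_continuous_image compact_sphere
        holomorphic_on_imp_continuous_on holomorphic_on_subset[OF holomorphic_inverse_power_series[of c, OF c]])
      auto
  ultimately have unif: "uniform_limit (sphere 0 R) ?f (\<lambda>s. inverse_power_series c s * exp (z * s)) sequentially"
    using \<open>1 < R\<close>
    by (intro bounded_bilinear.bounded_uniform_limit[OF bounded_bilinear_mult]
        inverse_power_series_uniform_limit[of c R, OF c] uniform_limit_const) auto
  \<comment> \<open>Cauchy's formula, applied at the centre of the circle.\<close>
  have summand: "((\<lambda>s. c n / s ^ Suc n * exp (z * s)) has_contour_integral
      2 * of_real pi * \<i> * (c n * z ^ n / fact n)) (circlepath 0 R)" for n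
    using has_contour_integral_lmul[OF Cauchy_has_contour_integral_higher_derivative_circlepath[of 0 R "\<lambda>s. exp (z * s)" 0 n,
          unfolded higher_deriv_exp_mult], of "c n"] \<open>1 < R\<close>
    by (simp add: continuous_intros holomorphic_intros mult_ac)
  have partial: "(?f N has_contour_integral (\<Sum>n<N. 2 * of_real pi * \<i> * (c n * z ^ n / fact n)))
      (circlepath 0 R)" for N
    unfolding sum_distrib_right by (intro has_contour_integral_sum summand) auto
  have "(\<lambda>N. contour_integral (circlepath 0 R) (?f N)) \<longlonglongrightarrow>
      contour_integral (circlepath 0 R) (\<lambda>s. inverse_power_series c s * exp (z * s))"
  proof (rule contour_integral_uniform_limit_circlepath(2)[OF _ unif])
    show "\<forall>\<^sub>F N in sequentially. ?f N contour_integrable_on circlepath 0 R"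
      using partial unfolding contour_integrable_on_def by (intro always_eventually) blast
  qed (use \<open>1 < R\<close> in auto)
  then show ?thesis
    unfolding sums_def contour_integral_unique[OF partial] .
qed

lemma circle_integral_eq_exponential_series:
  assumes c: "\<And>n. norm (c n) \<le> 1" and "1 < R"
  shows "contour_integral (circlepath 0 R) (\<lambda>s. inverse_power_series c s * exp (z * s)) =
    2 * of_real pi * \<i> * exponential_series c z"
proof -
  note s = exponential_series_sums_circle_integral[OF assms, where z = z]
  have "summable (\<lambda>n. c n * z ^ n / fact n)"
    using sums_summable[OF s] by (simp only: summable_cmult_iff) simp
  then have "(\<lambda>n. 2 * of_real pi * \<i> * (c n * z ^ n / fact n)) sums
      (2 * of_real pi * \<i> * exponential_series c z)"
    unfolding exponential_series_def by (intro sums_mult summable_sums)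
  then show ?thesis by (rule sums_unique2[OF s])
qed

lemma contour_integral_split_circlepath:
  assumes "continuous_on (sphere 0 R) f" "0 \<le> R" "0 < a" "a < 2 * pi"
  shows "contour_integral (circlepath 0 R) f =
    contour_integral (part_circlepath 0 R 0 a) f + contour_integral (part_circlepath 0 R a (2 * pi)) f"
proof -
  have "(\<lambda>t. f (of_real R * cis t) * of_real R * \<i> * cis t) integrable_on {0..2*pi}"
    using \<open>0 \<le> R\<close>
    by (intro integrable_continuous_real continuous_intros continuous_on_compose2[OF assms(1)])
      (auto simp: norm_mult)
  from Henstock_Kurzweil_Integration.integral_combine[OF _ _ this, of a] show ?thesis
    using assms(3-4) unfolding circlepath_def
    by (simp add: contour_integral_part_circlepath_eq)
qed

text \<open>
  The missing quarter circle lies in the half-plane \<open>Re s \<ge> 0\<close>, where \<open>exp (- r * s)\<close> has modulus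
  at most \<open>1\<close>. So opening the circle into an arc changes the transform on the negative real axis
  only by a bounded amount.
\<close>

lemma arc_transform_near_exponential_series:
  assumes c: "\<And>n. norm (c n) \<le> 1" and "1 < R"
  shows "\<exists>M. \<forall>r\<ge>0.
    norm (contour_integral (part_circlepath 0 R (pi / 2) (2 * pi))
            (\<lambda>s. inverse_power_series c s * exp (- of_real r * s)) -
          2 * of_real pi * \<i> * exponential_series c (- of_real r)) \<le> M"
proof -
  have cont: "continuous_on (sphere 0 R) (inverse_power_series c)"
    using \<open>1 < R\<close> by (intro holomorphic_on_imp_continuous_on
        holomorphic_on_subset[OF holomorphic_inverse_power_series[of c, OF c]]) auto
  then have "bounded (inverse_power_series c ` sphere 0 R)"
    by (intro compact_imp_bounded compact_continuous_image compact_sphere)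
  then obtain B where "B > 0" and B: "\<And>s. s \<in> sphere 0 R \<Longrightarrow> norm (inverse_power_series c s) \<le> B"
    unfolding bounded_pos by blast
  have gap: "norm (contour_integral (part_circlepath 0 R 0 (pi / 2))
      (\<lambda>s. inverse_power_series c s * exp (- of_real r * s))) \<le> B * R * \<bar>pi / 2 - 0\<bar>" if "0 \<le> r" for r
  proof (rule contour_integral_bound_part_circlepath)
    have sub: "path_image (part_circlepath 0 R 0 (pi / 2)) \<subseteq> sphere 0 R"
      using \<open>1 < R\<close> by (intro path_image_part_circlepath_subset') auto
    show "(\<lambda>s. inverse_power_series c s * exp (- of_real r * s)) contour_integrable_on part_circlepath 0 R 0 (pi / 2)"
      by (intro contour_integrable_continuous_part_circlepath continuous_intros
          continuous_on_subset[OF cont sub])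
    fix s assume s: "s \<in> path_image (part_circlepath 0 R 0 (pi / 2))"
    then obtain t where "0 \<le> t" "t \<le> pi / 2" "s = of_real R * cis t"
      unfolding path_image_part_circlepath' by (auto simp: closed_segment_eq_real_ivl)
    then have "0 \<le> Re s" using \<open>1 < R\<close> by (auto intro!: mult_nonneg_nonneg cos_ge_zero)
    then have "norm (exp (- of_real r * s)) \<le> 1" using \<open>0 \<le> r\<close> by simp
    then show "norm (inverse_power_series c s * exp (- of_real r * s)) \<le> B"
      using B[of s] s sub \<open>B > 0\<close> mult_mono[of "norm (inverse_power_series c s)" B "norm (exp (- of_real r * s))" 1]
      by (auto simp: norm_mult)
  qed (use \<open>B > 0\<close> \<open>1 < R\<close> in auto)
  have "norm (contour_integral (part_circlepath 0 R (pi / 2) (2 * pi))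
            (\<lambda>s. inverse_power_series c s * exp (- of_real r * s)) -
          2 * of_real pi * \<i> * exponential_series c (- of_real r)) \<le> B * R * \<bar>pi / 2 - 0\<bar>" if "0 \<le> r" for r
    unfolding circle_integral_eq_exponential_series[OF assms, symmetric]
    using gap[OF that] \<open>1 < R\<close> cont
    by (subst contour_integral_split_circlepath[where a = "pi / 2"])
      (auto intro!: continuous_intros)
  then show ?thesis by blast
qed

lemma arc_transform_entire_of_exponential_type:
  assumes c: "\<And>n. norm (c n) \<le> 1" and "1 < R"
  defines "\<gamma> \<equiv> part_circlepath 0 R (pi / 2) (2 * pi)"
  defines "F \<equiv> \<lambda>z. contour_integral \<gamma> (\<lambda>s. inverse_power_series c s * exp (z * s))"
  shows "F holomorphic_on UNIV" "exponential_type F"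
proof -
  have sub: "path_image \<gamma> \<subseteq> sphere 0 R"
    using \<open>1 < R\<close> unfolding \<gamma>_def by (intro path_image_part_circlepath_subset') auto
  have "continuous_on (sphere 0 R) (inverse_power_series c)"
    using \<open>1 < R\<close> by (intro holomorphic_on_imp_continuous_on
        holomorphic_on_subset[OF holomorphic_inverse_power_series[of c, OF c]]) auto
  then have cont: "continuous_on (path_image \<gamma>) (inverse_power_series c)"
    using sub by (rule continuous_on_subset)
  let ?d = "\<lambda>t. vector_derivative \<gamma> (at t)"
  have contd: "continuous_on {0..1} ?d"
    unfolding \<gamma>_def vector_derivative_part_circlepath by (intro continuous_intros)
  have cont\<gamma>: "continuous_on {0..1} \<gamma>"
    unfolding \<gamma>_def using path_part_circlepath by (auto simp: path_def)
  have contg: "continuous_on {0..1} (\<lambda>t. inverse_power_series c (\<gamma> t))"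
    by (intro continuous_on_compose2[OF cont] cont\<gamma>) (auto simp: path_image_def)
  have F: "F = (\<lambda>z. integral (cbox 0 1) (\<lambda>t. inverse_power_series c (\<gamma> t) * exp (z * \<gamma> t) * ?d t))"
    unfolding F_def contour_integral_integral by simp
  show "F holomorphic_on UNIV"
    unfolding F
  proof (rule leibniz_rule_holomorphic)
    show "((\<lambda>z. inverse_power_series c (\<gamma> t) * exp (z * \<gamma> t) * ?d t) has_field_derivative
       inverse_power_series c (\<gamma> t) * (exp (z * \<gamma> t) * \<gamma> t) * ?d t) (at z within UNIV)" for z t
      by (auto intro!: derivative_eq_intros)
    show "(\<lambda>t. inverse_power_series c (\<gamma> t) * exp (z * \<gamma> t) * ?d t) integrable_on cbox 0 1" for z
      by (auto intro!: integrable_continuous_real continuous_intros contg cont\<gamma> contd)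
    show "continuous_on (UNIV \<times> cbox 0 1)
       (\<lambda>(z, t). inverse_power_series c (\<gamma> t) * (exp (z * \<gamma> t) * \<gamma> t) * ?d t)"
      unfolding case_prod_unfold
      by (intro continuous_intros continuous_on_compose2[OF contg]
          continuous_on_compose2[OF cont\<gamma>] continuous_on_compose2[OF contd]) auto
  qed simp
  have "bounded (inverse_power_series c ` path_image \<gamma>)"
    by (intro compact_imp_bounded compact_continuous_image cont compact_path_image)
      (simp add: \<gamma>_def)
  then obtain B where "B > 0" and B: "\<And>s. s \<in> path_image \<gamma> \<Longrightarrow> norm (inverse_power_series c s) \<le> B"
    unfolding bounded_pos by blast
  have "norm (F z) \<le> B * exp (R * norm z) * R * \<bar>2 * pi - pi / 2\<bar>" for z
    unfolding F_def \<gamma>_def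
  proof (rule contour_integral_bound_part_circlepath)
    show "(\<lambda>s. inverse_power_series c s * exp (z * s)) contour_integrable_on part_circlepath 0 R (pi / 2) (2 * pi)"
      using cont unfolding \<gamma>_def
      by (intro contour_integrable_continuous_part_circlepath continuous_intros)
    fix s assume s: "s \<in> path_image (part_circlepath 0 R (pi / 2) (2 * pi))"
    then have "norm s = R" using sub unfolding \<gamma>_def by auto
    then have "norm (exp (z * s)) \<le> exp (R * norm z)"
      by (metis norm_exp norm_mult mult.commute)
    with B[of s] s show "norm (inverse_power_series c s * exp (z * s)) \<le> B * exp (R * norm z)"
      unfolding norm_mult \<gamma>_def using \<open>B > 0\<close> by (intro mult_mono) auto
  qed (use \<open>B > 0\<close> \<open>1 < R\<close> in auto)
  then have "norm (F z) \<le> (B * R * (3 * pi / 2)) * exp (R * norm z)" for z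
    by (simp add: field_simps)
  moreover have "B * R * (3 * pi / 2) > 0" "R > 0" using \<open>B > 0\<close> \<open>1 < R\<close> by auto
  ultimately show "exponential_type F" unfolding exponential_type_def by blast
qed

section \<open>Growth of sparse exponential series\<close>

lemma exp_series_sums: "(\<lambda>n. x ^ n / fact n) sums exp (x :: real)"
  using exp_converges[of x] by (simp add: divide_inverse mult.commute)

lemma summable_indicator_exp_series:
  fixes r :: real
  shows "summable (\<lambda>n. indicator S n * r ^ n / fact n)"
proof (rule summable_comparison_test')
  show "summable (\<lambda>n. \<bar>r\<bar> ^ n / fact n)" using exp_series_sums sums_summable by blast
  show "norm (indicator S n * r ^ n / fact n) \<le> \<bar>r\<bar> ^ n / fact n" if "n \<ge> 0" for n
    by (auto simp: indicator_def power_abs)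
qed

text \<open>
  The arc approximates the exponential series on the negative axis; for even exponents the terms are
  positive there too, so that they can be bounded individually without cancellation.
\<close>

lemma exponential_series_indicator_even:
  assumes "\<And>n. n \<in> S \<Longrightarrow> even n"
  shows "exponential_series (indicator S) (- of_real r) = of_real (\<Sum>n. indicator S n * r ^ n / fact n)"
proof -
  have "exponential_series (indicator S) (- of_real r) = (\<Sum>n. of_real (indicator S n * r ^ n / fact n))"
    unfolding exponential_series_def
    using assms by (intro suminf_cong) (auto simp: indicator_def)
  then show ?thesis using suminf_of_real[OF summable_indicator_exp_series] by metis
qed

text \<open>
  For \<open>r\<close> well inside a gap of \<open>S\<close>, the exponents below the gap are too small and those above it too
  large to contribute. Rescaling the exponential series by \<open>\<lambda>\<close> shows \<open>r ^ n / fact n\<close> to be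
  \<open>\<lambda> ^ n\<close> times the \<open>n\<close>-th term of the series of \<open>exp (r / \<lambda>)\<close>: the choice \<open>\<lambda> = 16\<close> serves below the
  gap, \<open>\<lambda> = 1/2\<close> above it.
\<close>

lemma sparse_exp_series_le:
  fixes r :: real
  assumes gap: "S \<inter> {M<..<N} = {}" and M: "64 * real M \<le> r" and N: "3 * r \<le> real N"
  shows "(\<Sum>n. indicator S n * r ^ n / fact n) \<le> exp (r / 8) + 1"
proof -
  have "0 \<le> r" using M by simp
  have "indicator S n * r ^ n / fact n \<le> 16 ^ M * ((r / 16) ^ n / fact n) + (1 / 2 ^ N) * ((2 * r) ^ n / fact n)" for n
  proof -
    have nonneg: "0 \<le> 16 ^ M * ((r / 16) ^ n / fact n)" "0 \<le> (1 / 2 ^ N) * ((2 * r) ^ n / fact n)"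
      using \<open>0 \<le> r\<close> by auto
    consider "n \<notin> S" | "n \<le> M" | "N \<le> n" using gap by force
    then show ?thesis
    proof cases
      case 2
      have "16 ^ n * ((r / 16) ^ n / fact n) \<le> 16 ^ M * ((r / 16) ^ n / fact n)"
        using 2 \<open>0 \<le> r\<close> by (intro mult_right_mono power_increasing) auto
      moreover have "16 ^ n * ((r / 16) ^ n / fact n) = r ^ n / fact n" by (simp add: power_divide)
      moreover have "indicator S n * r ^ n / fact n \<le> r ^ n / fact n"
        using \<open>0 \<le> r\<close> by (auto simp: indicator_def)
      ultimately show ?thesis using nonneg by linarith
    next
      case 3
      have "(1 / 2 ^ n) * ((2 * r) ^ n / fact n) \<le> (1 / 2 ^ N) * ((2 * r) ^ n / fact n)"
        using 3 \<open>0 \<le> r\<close> by (intro mult_right_mono frac_le power_increasing) auto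
      moreover have "(1 / 2 ^ n) * ((2 * r) ^ n / fact n) = r ^ n / fact n" by (simp add: power_mult_distrib)
      moreover have "indicator S n * r ^ n / fact n \<le> r ^ n / fact n"
        using \<open>0 \<le> r\<close> by (auto simp: indicator_def)
      ultimately show ?thesis using nonneg by linarith
    qed (use nonneg in auto)
  qed
  then have "(\<Sum>n. indicator S n * r ^ n / fact n) \<le> 16 ^ M * exp (r / 16) + (1 / 2 ^ N) * exp (2 * r)"
    by (rule sums_le[OF _ summable_sums[OF summable_indicator_exp_series]
          sums_add[OF sums_mult[OF exp_series_sums] sums_mult[OF exp_series_sums]]])
  also have "\<dots> \<le> exp (r / 16) * exp (r / 16) + 1"
  proof (intro add_mono mult_right_mono)
    \<comment> \<open>Below the gap: \<open>16 \<le> exp 4\<close>, and \<open>4 * M \<le> r / 16\<close>.\<close>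
    have "(2::real) \<le> exp 1" using exp_ge_add_one_self[of 1] by simp
    then have "(2::real) ^ 4 \<le> exp 1 ^ 4" by (intro power_mono) auto
    then have "(16::real) \<le> exp 4" by (simp flip: exp_of_nat_mult)
    then have "16 ^ M \<le> exp (4::real) ^ M" by (intro power_mono) auto
    also have "\<dots> = exp (4 * real M)" by (simp add: mult.commute flip: exp_of_nat_mult)
    also have "\<dots> \<le> exp (r / 16)" using M by simp
    finally show "16 ^ M \<le> exp (r / 16)" .
    \<comment> \<open>Above the gap: \<open>2 ^ N\<close> absorbs \<open>exp (2 * r)\<close>, since \<open>ln 2 \<ge> 2 / 3\<close> and \<open>N \<ge> 3 * r\<close>.\<close>
    have "2 * r \<le> real N * ln 2"
      using N mult_left_mono[OF ln2_ge_two_thirds, of "real N"] by simp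
    then have "exp (2 * r) \<le> exp (real N * ln 2)" by simp
    also have "\<dots> = 2 ^ N" by (simp add: exp_of_nat_mult)
    finally show "1 / 2 ^ N * exp (2 * r) \<le> 1" by simp
  qed simp
  finally show ?thesis by (simp flip: exp_add)
qed

text \<open>
  A single term suffices: for \<open>2 * n \<le> r\<close> it is at least \<open>2 ^ n * (n ^ n / fact n)\<close> and so at least
  \<open>2 ^ n\<close>, which is exponential in \<open>r\<close> as long as \<open>r\<close> is at most a fixed multiple of \<open>n\<close>.
\<close>

lemma sparse_exp_series_ge:
  fixes r :: real
  assumes "n \<in> S" and n: "2 * real n \<le> r" "r \<le> 3 * real n"
  shows "exp (2 * r / 9) \<le> (\<Sum>n. indicator S n * r ^ n / fact n)"
proof -
  have "0 \<le> r" using n by simp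
  have "2 * r / 9 \<le> real n * ln 2"
    using n mult_left_mono[OF ln2_ge_two_thirds, of "real n"] by simp
  then have "exp (2 * r / 9) \<le> exp (real n * ln 2)" by simp
  also have "\<dots> = 2 ^ n" by (simp add: exp_of_nat_mult)
  also have "\<dots> \<le> 2 ^ n * (real n ^ n / fact n)"
    using fact_le_power[of n, where 'a = real] by (simp add: field_simps)
  also have "\<dots> = (2 * real n) ^ n / fact n" by (simp add: power_mult_distrib)
  also have "\<dots> \<le> r ^ n / fact n"
    using n by (intro divide_right_mono power_mono) auto
  also have "\<dots> = (\<Sum>k\<in>{n}. indicator S k * r ^ k / fact k)" using \<open>n \<in> S\<close> by simp
  also have "\<dots> \<le> (\<Sum>k. indicator S k * r ^ k / fact k)"
    using \<open>0 \<le> r\<close> by (intro sum_le_suminf summable_indicator_exp_series) auto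
  finally show ?thesis .
qed

lemma powers_gap: "range (\<lambda>k. 300 ^ Suc k) \<inter> {300 ^ Suc k<..<(300::nat) ^ Suc (Suc k)} = {}"
proof -
  have "\<not> (Suc k < Suc j \<and> Suc j < Suc (Suc k))" for j by simp
  then show ?thesis by (auto simp del: power_Suc simp: power_strict_increasing_iff)
qed

section \<open>An arc and a density with irregular Laplace transform\<close>

theorem theorem3p1:
  shows "\<exists>(\<gamma> :: real \<Rightarrow> complex) (g :: complex \<Rightarrow> complex) U (F :: complex \<Rightarrow> complex).
           arc \<gamma> \<and> rectifiable_path \<gamma> \<and>
           open U \<and> path_image \<gamma> \<subseteq> U \<and> g holomorphic_on U \<and>
           (\<forall>z. ((\<lambda>s. g s * exp (z * s)) has_line_integral F z) \<gamma>) \<and>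
           F holomorphic_on UNIV \<and> exponential_type F \<and>
           \<not> completely_regular_growth F"
proof -
  \<comment> \<open>The ratio \<open>300\<close> leaves room for a window \<open>64 * n \<le> r \<le> 96 * n\<close> with \<open>3 * r\<close> below the next exponent.\<close>
  define S where "S = range (\<lambda>k. (300::nat) ^ Suc k)"
  define c :: "nat \<Rightarrow> complex" where "c = indicator S"
  define x where "x = (\<lambda>k. real (300 ^ Suc k))"
  define \<gamma> where "\<gamma> = part_circlepath 0 2 (pi / 2) (2 * pi)"
  define F where "F = (\<lambda>z. contour_integral \<gamma> (\<lambda>s. inverse_power_series c s * exp (z * s)))"
  define H where "H = (\<lambda>r::real. \<Sum>n. indicator S n * r ^ n / fact n :: real)"
  have c: "norm (c n) \<le> 1" for n by (simp add: c_def indicator_def)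

  have sub: "path_image \<gamma> \<subseteq> {s. 1 < norm s}"
    using path_image_part_circlepath_subset'[of 2 0 "pi / 2" "2 * pi"]
    unfolding \<gamma>_def by (auto simp: subset_iff)
  have deriv: "(\<gamma> has_vector_derivative vector_derivative \<gamma> (at t)) (at t within {0..1})" for t
    unfolding \<gamma>_def vector_derivative_part_circlepath
    by (rule has_vector_derivative_part_circlepath)
  have cont_deriv: "continuous_on {0..1} (\<lambda>t. vector_derivative \<gamma> (at t))"
    unfolding \<gamma>_def vector_derivative_part_circlepath by (intro continuous_intros)
  have "((\<lambda>s. inverse_power_series c s * exp (z * s)) has_line_integral F z) \<gamma>" for z
    unfolding F_def contour_integral_integral
    by (intro has_line_integral_C1 deriv cont_deriv continuous_intros
        continuous_on_subset[OF holomorphic_on_imp_continuous_on[OF holomorphic_inverse_power_series[of c, OF c]] sub])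
  moreover have "arc \<gamma>" unfolding \<gamma>_def by (intro arc_part_circlepath) auto
  moreover have "rectifiable_path \<gamma>" by (rule rectifiable_path_C1[OF deriv cont_deriv])
  moreover have "open {s::complex. 1 < norm s}" by (intro open_Collect_less continuous_intros)
  moreover have "F holomorphic_on UNIV" "exponential_type F"
    using arc_transform_entire_of_exponential_type[of c 2, OF c] unfolding F_def \<gamma>_def by simp_all
  moreover have "\<not> completely_regular_growth F"
  proof -
    have "even n" if "n \<in> S" for n using that unfolding S_def by (auto simp del: power_Suc simp: even_power)
    then have series: "exponential_series c (- of_real r) = of_real (H r)" for r
      unfolding c_def H_def by (rule exponential_series_indicator_even)
    obtain M where M: "\<And>r. 0 \<le> r \<Longrightarrow> norm (F (- of_real r) - 2 * of_real pi * \<i> * of_real (H r)) \<le> M"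
      using arc_transform_near_exponential_series[of c 2, OF c] unfolding F_def \<gamma>_def series
      by auto
    have norm_main: "norm (2 * of_real pi * \<i> * of_real (H r) :: complex) = 2 * pi * \<bar>H r\<bar>" for r
      by (simp add: norm_mult)
    have Hnonneg: "0 \<le> H r" if "0 \<le> r" for r
      unfolding H_def using that by (intro suminf_nonneg summable_indicator_exp_series) auto
    have upper: "norm (F (- of_real r)) \<le> 2 * pi * H r + M"
      and lower: "2 * pi * H r - M \<le> norm (F (- of_real r))" if "0 \<le> r" for r
      using M[OF that] norm_main[of r] Hnonneg[OF that]
        norm_triangle_ineq2[of "F (- of_real r)" "2 * of_real pi * \<i> * of_real (H r)"]
        norm_triangle_ineq3[of "F (- of_real r)" "2 * of_real pi * \<i> * of_real (H r)"]
      by linarith+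
    have x_top: "filterlim x at_top sequentially"
      unfolding x_def by real_asymp
    \<comment> \<open>Inside the gaps the rate is at most \<open>1 / 8\<close>; the slack up to \<open>1 / 7\<close> absorbs the constants and the integral over the removed quarter circle.\<close>
    have "\<forall>\<^sub>F r in at_top. 2 * pi * (exp (r / 8) + 1) + M \<le> exp (1 / 7 * r)" by real_asymp
    with eventually_ge_at_top[of 0]
    have small: "\<forall>\<^sub>F r in at_top. (\<exists>k. r \<in> {64 * x k..96 * x k}) \<longrightarrow>
        norm (F (of_real r * cis pi)) \<le> exp (1 / 7 * r)"
    proof eventually_elim
      case (elim r)
      show ?case
      proof (intro impI, elim exE)
        fix k assume k: "r \<in> {64 * x k..96 * x k}"
        have "H r \<le> exp (r / 8) + 1"
          unfolding H_def
        proof (rule sparse_exp_series_le)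
          show "S \<inter> {300 ^ Suc k<..<300 ^ Suc (Suc k)} = {}" unfolding S_def by (rule powers_gap)
          show "64 * real (300 ^ Suc k) \<le> r" using k by (simp add: x_def)
          show "3 * r \<le> real (300 ^ Suc (Suc k))" using k by (simp add: x_def)
        qed
        then have "2 * pi * H r \<le> 2 * pi * (exp (r / 8) + 1)" by (intro mult_left_mono) auto
        with upper[OF elim(1)] elim(2) have "norm (F (- of_real r)) \<le> exp (1 / 7 * r)" by linarith
        then show "norm (F (of_real r * cis pi)) \<le> exp (1 / 7 * r)" by simp
      qed
    qed
    \<comment> \<open>Just above an exponent the rate is at least \<open>2 / 9\<close>, again with slack down to \<open>1 / 6\<close>.\<close>
    have "\<forall>\<^sub>F r in at_top. exp (1 / 6 * r) < 2 * pi * exp (2 * r / 9) - M" by real_asymp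
    with eventually_ge_at_top[of 0]
    have large: "\<forall>\<^sub>F r in at_top. (\<exists>k. r \<in> {2 * x k..3 * x k}) \<longrightarrow>
        norm (F (of_real r * cis pi)) > exp (1 / 6 * r)"
    proof eventually_elim
      case (elim r)
      show ?case
      proof (intro impI, elim exE)
        fix k assume k: "r \<in> {2 * x k..3 * x k}"
        have "exp (2 * r / 9) \<le> H r"
          unfolding H_def
        proof (rule sparse_exp_series_ge)
          show "300 ^ Suc k \<in> S" unfolding S_def by (rule rangeI)
          show "2 * real (300 ^ Suc k) \<le> r" "r \<le> 3 * real (300 ^ Suc k)"
            using k by (simp_all add: x_def)
        qed
        then have "2 * pi * exp (2 * r / 9) \<le> 2 * pi * H r" by (intro mult_left_mono) auto
        with lower[OF elim(1)] elim(2) have "norm (F (- of_real r)) > exp (1 / 6 * r)" by linarith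
        then show "norm (F (of_real r * cis pi)) > exp (1 / 6 * r)" by simp
      qed
    qed
    show ?thesis
      by (rule not_regular_growth_if_oscillating[OF _ _ _ _ x_top _ small large]) simp_all
  qed
  ultimately show ?thesis
    using sub holomorphic_inverse_power_series[of c, OF c]
    by (intro exI[of _ \<gamma>] exI[of _ "inverse_power_series c"] exI[of _ "{s. 1 < norm s}"] exI[of _ F])
      simp
qed

end
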